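(* Let $\mathcal{A}$ be a unital $C^*$-algebra, let $\mathcal{F}\subseteq\mathcal{A}$ be an ideal of finite type elements, and let $a\in\mathcal{A}$. Then the following holds. 1) If $a\in\mathcal{K}\Phi_{+}^{-}(\mathcal{A})$ and $f\in\mathcal{F}$, then $a+f\in\mathcal{K}\Phi_{+}^{-}(\mathcal{A})$. 2) If $a\in\mathcal{K}\Phi_{-}^{+}(\mathcal{A})$ and $f\in\mathcal{F}$, then $a+f\in\mathcal{K}\Phi_{-}^{+}(\mathcal{A})$. 3) If $a\in\mathcal{K}\Phi_{0}(\mathcal{A})$ and $f\in\mathcal{F}$, then $a+f\in\mathcal{K}\Phi_{0}(\mathcal{A})$.
   Context: Ideal of finite type elements: a subalgebra $\mathcal{F}\subseteq\mathcal{A}$ such that (i) $\mathcal{F}$ is a selfadjoint ideal: $ab,ba\in\mathcal{F}$ for all $a\in\mathcal{A}$, $b\in\mathcal{F}$, and $a\in\mathcal{F}$ implies $a^*\in\mathcal{F}$; (ii) there is an approximate unit $(p_\alpha)$ (in the norm topology) for $\mathcal{F}$ consisting of projections; (iii) if $p,q\in\mathcal{F}$ are projections, then there exists $v\in\mathcal{A}$ such that $vv^*=q$ and $v^*v\perp p$, i.e. $v^*v+p$ is a projection. For projections $p,q\in\mathcal{A}$: $p\sim q$ means there is $v\in\mathcal{A}$ with $vv^*=p$, $v^*v=q$; $p\preceq q$ means there is a projection $p'\in\mathcal{A}$ with $p'\le q$ and $p\sim p'$. For $a\in\mathcal{A}$ and projections $p,q\in\mathcal{A}$, $a$ is invertible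 up to the pair $(p,q)$ if, with $a'=(1-q)a(1-p)$, there is $b\in\mathcal{A}$ with $b=(1-p)b(1-q)$, $a'b=1-q$, $ba'=1-p$. With respect to the fixed ideal $\mathcal{F}$: $\mathcal{K}\Phi_{+}^{-}(\mathcal{A})$ (upper semi-Weyl type), resp. $\mathcal{K}\Phi_{-}^{+}(\mathcal{A})$ (lower semi-Weyl type), resp. $\mathcal{K}\Phi_{0}(\mathcal{A})$ (Weyl type), is the set of $a\in\mathcal{A}$ that are invertible up to some pair $(p,q)$ of projections in $\mathcal{A}$ with $p\in\mathcal{F}$ and $p\preceq q$, resp. $q\in\mathcal{F}$ and $q\preceq p$, resp. $p,q\in\mathcal{F}$ and $p\sim q$. *)

theory Defs
  imports "HOL-Analysis.Analysis"
begin

text \<open>Unital complex \<open>C\<^sup>*\<close>-algebras. The superclass \<^class>\<open>monoid_mult\<close> (rather than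
  \<^class>\<open>ring_1\<close>) supplies the unit without excluding the zero algebra.\<close>

class cstar_algebra_1 = real_normed_algebra + banach + monoid_mult +
  fixes scaleC :: "complex \<Rightarrow> 'a \<Rightarrow> 'a"  (infixr \<open>*\<^sub>C\<close> 75)
    and star :: "'a \<Rightarrow> 'a"  (\<open>_\<^sup>\<star>\<close> [1000] 999)
  assumes scaleC_add_right: "c *\<^sub>C (x + y) = c *\<^sub>C x + c *\<^sub>C y"
    and scaleC_add_left: "(c + d) *\<^sub>C x = c *\<^sub>C x + d *\<^sub>C x"
    and scaleC_scaleC: "c *\<^sub>C (d *\<^sub>C x) = (c * d) *\<^sub>C x"
    and scaleC_of_real: "complex_of_real r *\<^sub>C x = r *\<^sub>R x"
    and mult_scaleC_left: "(c *\<^sub>C x) * y = c *\<^sub>C (x * y)"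
    and mult_scaleC_right: "x * (c *\<^sub>C y) = c *\<^sub>C (x * y)"
    and norm_scaleC: "norm (c *\<^sub>C x) = cmod c * norm x"
    and star_star: "(x\<^sup>\<star>)\<^sup>\<star> = x"
    and star_add: "(x + y)\<^sup>\<star> = x\<^sup>\<star> + y\<^sup>\<star>"
    and star_scaleC: "(c *\<^sub>C x)\<^sup>\<star> = cnj c *\<^sub>C x\<^sup>\<star>"
    and star_mult: "(x * y)\<^sup>\<star> = y\<^sup>\<star> * x\<^sup>\<star>"
    and cstar_identity: "norm (x\<^sup>\<star> * x) = (norm x)\<^sup>2"

definition projection :: "'a::cstar_algebra_1 \<Rightarrow> bool" where
  "projection p \<longleftrightarrow> p\<^sup>\<star> = p \<and> p * p = p"

text \<open>The order \<open>p \<le> q\<close> on projections.\<close>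

definition subprojection :: "'a::cstar_algebra_1 \<Rightarrow> 'a \<Rightarrow> bool" where
  "subprojection p q \<longleftrightarrow> projection p \<and> projection q \<and> p * q = p \<and> q * p = p"

definition mvn_equiv :: "'a::cstar_algebra_1 \<Rightarrow> 'a \<Rightarrow> bool"  (infix \<open>\<approx>\<^sub>M\<close> 50) where
  "p \<approx>\<^sub>M q \<longleftrightarrow> (\<exists>v. v * v\<^sup>\<star> = p \<and> v\<^sup>\<star> * v = q)"

definition mvn_le :: "'a::cstar_algebra_1 \<Rightarrow> 'a \<Rightarrow> bool"  (infix \<open>\<preceq>\<^sub>M\<close> 50) where
  "p \<preceq>\<^sub>M q \<longleftrightarrow> (\<exists>p'. subprojection p' q \<and> p \<approx>\<^sub>M p')"

definition subalgebra :: "'a::cstar_algebra_1 set \<Rightarrow> bool" where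
  "subalgebra F \<longleftrightarrow> 0 \<in> F \<and> (\<forall>x\<in>F. \<forall>y\<in>F. x + y \<in> F \<and> x * y \<in> F) \<and>
     (\<forall>c. \<forall>x\<in>F. c *\<^sub>C x \<in> F)"

text \<open>A net \<open>u\<close> in \<open>F\<close>, indexed by the set \<open>I\<close> directed by the preorder \<open>r\<close>, that is a two-sided
  approximate unit for \<open>F\<close> in norm. Neither monotonicity of the net nor closedness of \<open>F\<close> is
  required.\<close>

definition approximate_unit ::
    "'a::cstar_algebra_1 set \<Rightarrow> 'i set \<Rightarrow> 'i rel \<Rightarrow> ('i \<Rightarrow> 'a) \<Rightarrow> bool" where
  "approximate_unit F I r u \<longleftrightarrow>
     I \<noteq> {} \<and> preorder_on I r \<and> (\<forall>i\<in>I. \<forall>j\<in>I. \<exists>k\<in>I. (i, k) \<in> r \<and> (j, k) \<in> r) \<and>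
     (\<forall>i\<in>I. u i \<in> F) \<and>
     (\<forall>x\<in>F. \<forall>\<epsilon>>0. \<exists>i\<in>I. \<forall>j\<in>I. (i, j) \<in> r \<longrightarrow>
        norm (u j * x - x) < \<epsilon> \<and> norm (x * u j - x) < \<epsilon>)"

text \<open>The \<open>'i itself\<close> argument names the type from which the index set of the approximate unit is
  drawn. Theorems leave \<open>'i\<close> as a type variable, so nets over arbitrary directed sets are covered.\<close>

definition finite_type_ideal :: "'i itself \<Rightarrow> 'a::cstar_algebra_1 set \<Rightarrow> bool" where
  "finite_type_ideal (_ :: 'i itself) F \<longleftrightarrow>
     subalgebra F \<and>
     (\<forall>a. \<forall>b\<in>F. a * b \<in> F \<and> b * a \<in> F) \<and> (\<forall>a\<in>F. a\<^sup>\<star> \<in> F) \<and>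
     (\<exists>(I :: 'i set) r u. approximate_unit F I r u \<and> (\<forall>i\<in>I. projection (u i))) \<and>
     (\<forall>p\<in>F. \<forall>q\<in>F. projection p \<and> projection q \<longrightarrow>
        (\<exists>v. v * v\<^sup>\<star> = q \<and> projection (v\<^sup>\<star> * v + p)))"

definition invertible_upto :: "'a::cstar_algebra_1 \<Rightarrow> 'a \<Rightarrow> 'a \<Rightarrow> bool" where
  "invertible_upto a p q \<longleftrightarrow>
     (let a' = (1 - q) * a * (1 - p) in
       \<exists>b. b = (1 - p) * b * (1 - q) \<and> a' * b = 1 - q \<and> b * a' = 1 - p)"

definition upper_semi_Weyl :: "'a::cstar_algebra_1 set \<Rightarrow> 'a set"  (\<open>\<K>\<Phi>\<^sub>+\<^sup>-\<close>) where
  "\<K>\<Phi>\<^sub>+\<^sup>- F = {a. \<exists>p q. projection p \<and> projection q \<and> invertible_upto a p q \<and>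
     p \<in> F \<and> p \<preceq>\<^sub>M q}"

definition lower_semi_Weyl :: "'a::cstar_algebra_1 set \<Rightarrow> 'a set"  (\<open>\<K>\<Phi>\<^sub>-\<^sup>+\<close>) where
  "\<K>\<Phi>\<^sub>-\<^sup>+ F = {a. \<exists>p q. projection p \<and> projection q \<and> invertible_upto a p q \<and>
     q \<in> F \<and> q \<preceq>\<^sub>M p}"

definition Weyl :: "'a::cstar_algebra_1 set \<Rightarrow> 'a set"  (\<open>\<K>\<Phi>\<^sub>0\<close>) where
  "\<K>\<Phi>\<^sub>0 F = {a. \<exists>p q. projection p \<and> projection q \<and> invertible_upto a p q \<and>
     p \<in> F \<and> q \<in> F \<and> p \<approx>\<^sub>M q}"

end

theory Submission
  imports Defs
begin

text \<open>An element is upper semi-Weyl if and only if it is a left-invertible element plus an element of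
  \<open>F\<close>, and Weyl if and only if it is an invertible element plus an element of \<open>F\<close>; both descriptions
  are stable under adding elements of \<open>F\<close>, and the lower semi-Weyl case follows by taking adjoints.
  The passage from a left-invertible element back to Murray--von Neumann comparison needs polar
  decomposition, hence a square root of \<open>1 + x\<^sup>\<star> x\<close>, which is obtained from the \<open>C\<^sup>*\<close>-identity without
  spectral theory.\<close>

section \<open>Involution and norm: elementary consequences of the axioms\<close>

lemma star_zero [simp]: "(0::'a::cstar_algebra_1)\<^sup>\<star> = 0"
  using star_add[of "0::'a" 0] by simp

lemma star_minus: "(- x)\<^sup>\<star> = - (x::'a::cstar_algebra_1)\<^sup>\<star>"
  using star_add[of x "- x"] by (simp add: eq_neg_iff_add_eq_0 add.commute)

lemma star_diff: "(x - y)\<^sup>\<star> = (x::'a::cstar_algebra_1)\<^sup>\<star> - y\<^sup>\<star>"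
  using star_add[of x "- y"] by (simp add: star_minus)

lemma star_one [simp]: "(1::'a::cstar_algebra_1)\<^sup>\<star> = 1"
  by (metis mult_1 mult.right_neutral star_mult star_star)

lemma star_scaleR: "(r *\<^sub>R x)\<^sup>\<star> = r *\<^sub>R (x::'a::cstar_algebra_1)\<^sup>\<star>"
  using star_scaleC[of "complex_of_real r" x] by (simp add: scaleC_of_real)

text \<open>The C*-identity and submultiplicativity bound every norm by the norm of the adjoint;
  applying this to \<open>x\<close> and to its adjoint gives equality.\<close>

lemma norm_star: "norm (x\<^sup>\<star>) = norm (x::'a::cstar_algebra_1)"
proof -
  have le: "norm z \<le> norm (z\<^sup>\<star>)" for z :: 'a
  proof -
    have "norm z * norm z \<le> norm (z\<^sup>\<star>) * norm z"
      using norm_mult_ineq[of "z\<^sup>\<star>" z] by (simp add: cstar_identity power2_eq_square)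
    then show ?thesis
      by (cases "z = 0") auto
  qed
  show ?thesis
    using le[of x] le[of "x\<^sup>\<star>"] by (simp add: star_star)
qed

lemma norm_selfadjoint_square:
  "x\<^sup>\<star> = x \<Longrightarrow> norm (x * x) = (norm (x::'a::cstar_algebra_1))\<^sup>2"
  using cstar_identity[of x] by simp

text \<open>The norm of 1 equals its own square, so it is 0 or 1; the value 0 occurs in the zero
  algebra.\<close>

lemma norm_one_le: "norm (1::'a::cstar_algebra_1) \<le> 1"
proof -
  have "norm (1::'a) = (norm (1::'a))\<^sup>2"
    using cstar_identity[of "1::'a"] by simp
  then show ?thesis
    by (cases "norm (1::'a) = 0") (auto simp: power2_eq_square)
qed

lemma norm_scaleR_one_le: "norm (r *\<^sub>R (1::'a::cstar_algebra_1)) \<le> \<bar>r\<bar>"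
  using mult_left_mono[OF norm_one_le, of "\<bar>r\<bar>"] by simp

lemma star_self_mult: "(x\<^sup>\<star> * x)\<^sup>\<star> = x\<^sup>\<star> * (x::'a::cstar_algebra_1)"
  by (simp add: star_mult star_star)

section \<open>Inverses, and square roots of elements near a scalar\<close>

lemma inverse_selfadjoint:
  fixes x y :: "'a::cstar_algebra_1"
  assumes "x\<^sup>\<star> = x" "x * y = 1" "y * x = 1"
  shows "y\<^sup>\<star> = y"
proof -
  have "y\<^sup>\<star> * x = 1"
    using star_mult[of x y] assms by simp
  then have "y\<^sup>\<star> * (x * y) = y"
    by (simp flip: mult.assoc)
  then show ?thesis
    using assms by simp
qed

lemma inverse_commute:
  fixes x y z :: "'a::monoid_mult"
  assumes "x * y = 1" "y * x = 1" "z * x = x * z"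
  shows "z * y = y * z"
proof -
  have "z * y = (y * x) * z * y"
    using assms by simp
  also have "\<dots> = y * (z * x) * y"
    using assms(3) by (simp add: mult.assoc)
  also have "\<dots> = y * z"
    using assms(1) by (simp add: mult.assoc)
  finally show ?thesis .
qed

text \<open>A right and a left inverse arise as fixed points of the contractions \<open>y\<close> to
  \<open>1 + z * y\<close> and \<open>y\<close> to \<open>1 + y * z\<close>; having both, they
  coincide.\<close>

lemma neumann_inverse:
  fixes z :: "'a::cstar_algebra_1"
  assumes "norm z < 1"
  obtains y where "(1 - z) * y = 1" "y * (1 - z) = 1"
proof -
  have "\<exists>!y\<in>UNIV. 1 + z * y = y"
    by (rule Banach_fix[of UNIV "norm z"])
       (use assms in \<open>auto simp: dist_norm complete_UNIV norm_mult_ineq simp flip: right_diff_distrib\<close>)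
  then obtain y where "1 + z * y = y" by auto
  then have y: "(1 - z) * y = 1" by (simp add: left_diff_distrib diff_eq_eq)
  have "\<exists>!y\<in>UNIV. 1 + y * z = y"
    by (rule Banach_fix[of UNIV "norm z"])
       (use assms in \<open>auto simp: dist_norm complete_UNIV mult.commute[of "norm z"] norm_mult_ineq
          simp flip: left_diff_distrib\<close>)
  then obtain y' where "1 + y' * z = y'" by auto
  then have y': "y' * (1 - z) = 1" by (simp add: right_diff_distrib diff_eq_eq)
  have "y' = y' * ((1 - z) * y)" by (simp add: y)
  also have "\<dots> = y" by (simp add: y' flip: mult.assoc)
  finally show ?thesis using that y y' by simp
qed

text \<open>Writing the root as \<open>1 - y\<close>, the equation becomes \<open>y = (z + y\<^sup>2) / 2\<close>, whose right-hand side
  is a contraction of the ball of radius \<open>1 - sqrt (1 - \<parallel>z\<parallel>)\<close>.\<close>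

lemma sqrt_one_minus:
  fixes z :: "'a::cstar_algebra_1"
  assumes sa: "z\<^sup>\<star> = z" and less: "norm z < 1"
  obtains c where "c\<^sup>\<star> = c" "c * c = 1 - z" "\<And>x. x * z = z * x \<Longrightarrow> x * c = c * x"
proof -
  define \<rho> where "\<rho> = 1 - sqrt (1 - norm z)"
  have \<rho>: "0 \<le> \<rho>" "\<rho> < 1" "norm z + \<rho> * \<rho> = 2 * \<rho>"
  proof -
    have "sqrt (1 - norm z) * sqrt (1 - norm z) = 1 - norm z"
      using less by simp
    then show "norm z + \<rho> * \<rho> = 2 * \<rho>"
      by (simp add: \<rho>_def algebra_simps)
  qed (use less in \<open>auto simp: \<rho>_def\<close>)
  \<comment> \<open>Self-adjointness and commutation with everything that commutes with
    \<open>z\<close> are closed conditions preserved by \<open>g\<close>, so the fixed point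
    inherits them.\<close>
  define S where "S = {y. norm y \<le> \<rho> \<and> y\<^sup>\<star> = y \<and> (\<forall>x. x * z = z * x \<longrightarrow> x * y = y * x)}"
  define g where "g = (\<lambda>y. (1/2) *\<^sub>R (z + y * y))"
  have lin: "bounded_linear (star :: 'a \<Rightarrow> 'a)"
    by (rule bounded_linear_intro[of _ 1]) (auto simp: star_add star_scaleR norm_star)
  have S_eq: "S = cball 0 \<rho> \<inter> {y. y\<^sup>\<star> = y} \<inter> (\<Inter>x\<in>{x. x * z = z * x}. {y. x * y = y * x})"
    by (auto simp: S_def)
  have "closed S"
    unfolding S_eq
    by (intro closed_Int closed_cball closed_INT ballI closed_Collect_eq continuous_intros
        bounded_linear.continuous_on[OF lin])
  then have "complete S" by (simp add: complete_eq_closed)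
  moreover have "S \<noteq> {}"
    using \<rho> by (auto simp: S_def intro!: exI[of _ 0])
  moreover have "g ` S \<subseteq> S"
  proof (rule image_subsetI)
    fix y assume "y \<in> S"
    then have y: "norm y \<le> \<rho>" "y\<^sup>\<star> = y" "\<And>x. x * z = z * x \<Longrightarrow> x * y = y * x"
      unfolding S_def by blast+
    have "norm (z + y * y) \<le> norm z + norm y * norm y"
      by (meson norm_triangle_ineq norm_mult_ineq add_left_mono order_trans)
    also have "\<dots> \<le> norm z + \<rho> * \<rho>"
      using y(1) \<rho> by (intro add_left_mono mult_mono) auto
    finally have "norm (g y) \<le> \<rho>"
      using \<rho> by (simp add: g_def)
    moreover have "x * g y = g y * x" if "x * z = z * x" for x
    proof -
      have xy: "x * y = y * x" using y(3) that by blast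
      then have "x * (y * y) = y * y * x" by (metis mult.assoc)
      then show ?thesis using that by (simp add: g_def distrib_left distrib_right)
    qed
    moreover have "(g y)\<^sup>\<star> = g y"
      using y(2) sa by (simp add: g_def star_scaleR star_add star_mult)
    ultimately show "g y \<in> S"
      unfolding S_def by blast
  qed
  moreover have "dist (g y) (g y') \<le> \<rho> * dist y y'" if "y \<in> S" "y' \<in> S" for y y'
  proof -
    have norms: "norm y \<le> \<rho>" "norm y' \<le> \<rho>"
      using that unfolding S_def by blast+
    have "norm (y * y - y' * y') = norm (y * (y - y') + (y - y') * y')"
      by (simp add: algebra_simps)
    also have "\<dots> \<le> norm y * norm (y - y') + norm (y - y') * norm y'"
      by (intro norm_triangle_le add_mono norm_mult_ineq)
    also have "\<dots> \<le> \<rho> * norm (y - y') + norm (y - y') * \<rho>"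
      using norms by (intro add_mono mult_left_mono mult_right_mono) auto
    finally show ?thesis
      by (simp add: g_def dist_norm flip: scaleR_diff_right)
  qed
  ultimately have "\<exists>!y\<in>S. g y = y"
    using \<rho> by (intro Banach_fix) auto
  then obtain y where "y \<in> S" "g y = y" by blast
  then have y: "y\<^sup>\<star> = y" "\<And>x. x * z = z * x \<Longrightarrow> x * y = y * x" "g y = y"
    unfolding S_def by blast+
  have "2 *\<^sub>R g y = z + y * y" by (simp add: g_def)
  then have "y + y = z + y * y" using y(3) by (simp add: scaleR_2)
  then have "(1 - y) * (1 - y) = 1 - z"
    by (simp add: algebra_simps)
  moreover have "(1 - y)\<^sup>\<star> = 1 - y" using y(1) by (simp add: star_diff)
  moreover have "x * (1 - y) = (1 - y) * x" if "x * z = z * x" for x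
    using y(2)[OF that] by (simp add: left_diff_distrib right_diff_distrib)
  ultimately show ?thesis using that by blast
qed

text \<open>Rescaling by \<open>T\<close> reduces this to a root of \<open>1 - z\<close> with
  \<open>norm z < 1\<close>.\<close>

lemma sqrt_near_scalar:
  fixes k :: "'a::cstar_algebra_1"
  assumes sa: "k\<^sup>\<star> = k" and T: "norm (T *\<^sub>R 1 - k) < T"
  obtains c where "c\<^sup>\<star> = c" "c * c = k" "\<And>x. x * k = k * x \<Longrightarrow> x * c = c * x"
proof -
  have "T > 0" using T norm_ge_zero[of "T *\<^sub>R 1 - k"] by linarith
  define z where "z = 1 - (1/T) *\<^sub>R k"
  have z: "z = (1/T) *\<^sub>R (T *\<^sub>R 1 - k)"
    using \<open>T > 0\<close> by (simp add: z_def scaleR_diff_right)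
  have "z\<^sup>\<star> = z" using sa by (simp add: z_def star_diff star_scaleR)
  moreover have "norm z < 1" using T \<open>T > 0\<close> by (simp add: z)
  ultimately obtain c where c: "c\<^sup>\<star> = c" "c * c = 1 - z" "\<And>x. x * z = z * x \<Longrightarrow> x * c = c * x"
    using sqrt_one_minus by blast
  show ?thesis
  proof
    show "(sqrt T *\<^sub>R c)\<^sup>\<star> = sqrt T *\<^sub>R c" by (simp add: star_scaleR c)
    show "(sqrt T *\<^sub>R c) * (sqrt T *\<^sub>R c) = k" using \<open>T > 0\<close> by (simp add: c z_def)
    show "x * (sqrt T *\<^sub>R c) = sqrt T *\<^sub>R c * x" if "x * k = k * x" for x
      using c(3)[of x] that by (simp add: z_def left_diff_distrib right_diff_distrib)
  qed
qed

section \<open>Norm estimates from sums of squares, replacing positivity\<close>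

text \<open>The element \<open>s + i t\<close> satisfies \<open>u\<^sup>\<star> u = L\<close>, and \<open>s\<close> is its real part.\<close>

lemma norm_le_of_sum_squares_eq_scalar:
  fixes s t :: "'a::cstar_algebra_1"
  assumes sa: "s\<^sup>\<star> = s" "t\<^sup>\<star> = t" and comm: "s * t = t * s"
    and eq: "s * s + t * t = L *\<^sub>R 1" and "L \<ge> 0"
  shows "(norm s)\<^sup>2 \<le> L"
proof -
  define u where "u = s + \<i> *\<^sub>C t"
  have i0: "\<i> *\<^sub>C x + (- \<i>) *\<^sub>C x = 0" for x :: 'a
    using scaleC_add_left[of \<i> "- \<i>" x] scaleC_of_real[of 0 x] by simp
  have us: "u\<^sup>\<star> = s + (- \<i>) *\<^sub>C t"
    by (simp add: u_def star_add star_scaleC sa)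
  have "u\<^sup>\<star> * u = s * s + t * t + (\<i> *\<^sub>C (s * t) + (- \<i>) *\<^sub>C (s * t))"
    unfolding us by (simp add: u_def distrib_left distrib_right mult_scaleC_left mult_scaleC_right
        scaleC_add_right scaleC_scaleC comm scaleC_of_real[of 1, simplified])
  then have "u\<^sup>\<star> * u = L *\<^sub>R 1" by (simp add: i0 eq)
  then have "(norm u)\<^sup>2 \<le> L"
    using cstar_identity[of u] norm_scaleR_one_le[of L, where 'a='a] \<open>L \<ge> 0\<close> by simp
  moreover have "u + u\<^sup>\<star> = 2 *\<^sub>R s + (\<i> *\<^sub>C t + (- \<i>) *\<^sub>C t)"
    unfolding us by (simp add: u_def scaleR_2)
  then have "norm (2 *\<^sub>R s) \<le> norm u + norm u"
    using norm_triangle_ineq[of u "u\<^sup>\<star>"] by (simp add: i0 norm_star)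
  then have "(norm s)\<^sup>2 \<le> (norm u)\<^sup>2" by (intro power_mono) auto
  ultimately show ?thesis by linarith
qed

text \<open>The difference has a self-adjoint root \<open>c\<close> commuting with \<open>s\<close>,
  and the squares of \<open>c\<close> and \<open>s\<close> add up to \<open>T\<close>. The
  conclusion is the norm form of the positivity of \<open>s * s\<close>.\<close>

lemma norm_scalar_minus_square_le:
  fixes s :: "'a::cstar_algebra_1"
  assumes sa: "s\<^sup>\<star> = s" and T: "(norm s)\<^sup>2 < T"
  shows "norm (T *\<^sub>R 1 - s * s) \<le> T"
proof -
  have "T > 0" using T zero_le_power2[of "norm s"] by linarith
  obtain c where c: "c\<^sup>\<star> = c" "c * c = T *\<^sub>R 1 - s * s"
    "\<And>x. x * (T *\<^sub>R 1 - s * s) = (T *\<^sub>R 1 - s * s) * x \<Longrightarrow> x * c = c * x"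
  proof (rule sqrt_near_scalar)
    show "(T *\<^sub>R 1 - s * s)\<^sup>\<star> = T *\<^sub>R 1 - s * s"
      by (simp add: star_diff star_scaleR star_mult sa)
    show "norm (T *\<^sub>R 1 - (T *\<^sub>R 1 - s * s)) < T"
      using T sa by (simp add: norm_selfadjoint_square)
  qed blast
  have "s * c = c * s" by (rule c) (simp add: algebra_simps)
  then have "(norm c)\<^sup>2 \<le> T"
    using c(1,2) sa \<open>T > 0\<close> by (intro norm_le_of_sum_squares_eq_scalar[of c s]) auto
  then show ?thesis
    using norm_selfadjoint_square[OF c(1)] by (simp add: c)
qed

text \<open>The bound on \<open>T *\<^sub>R 1 - R\<close> expresses that \<open>R\<close> is
  positive. In this form positivity passes to sums by the triangle inequality.\<close>

lemma norm_le_of_positive_complement: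
  fixes s R :: "'a::cstar_algebra_1"
  assumes sa: "s\<^sup>\<star> = s" and eq: "s * s + R = L *\<^sub>R 1" and "L \<ge> 0"
    and R: "norm (T *\<^sub>R 1 - R) \<le> T"
  shows "(norm s)\<^sup>2 \<le> L"
proof (rule field_le_epsilon)
  fix e :: real assume e: "e > 0"
  \<comment> \<open>Here \<open>k\<close> is \<open>R\<close> shifted by \<open>e\<close>, which
    makes the norm bound strict, as the existence of a root requires.\<close>
  define k where "k = (L + e) *\<^sub>R 1 - s * s"
  have "(T + e) *\<^sub>R 1 - k = T *\<^sub>R 1 - R"
    using eq by (simp add: k_def scaleR_add_left flip: eq)
  then have "norm ((T + e) *\<^sub>R 1 - k) < T + e" using R e by simp
  moreover have "k\<^sup>\<star> = k" by (simp add: k_def star_diff star_scaleR star_mult sa)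
  ultimately obtain c where c: "c\<^sup>\<star> = c" "c * c = k" "\<And>x. x * k = k * x \<Longrightarrow> x * c = c * x"
    using sqrt_near_scalar by blast
  have "s * c = c * s" by (rule c) (simp add: k_def algebra_simps)
  then show "(norm s)\<^sup>2 \<le> L + e"
    using c(1,2) sa e \<open>L \<ge> 0\<close> by (intro norm_le_of_sum_squares_eq_scalar[of s c]) (auto simp: k_def)
qed

text \<open>Up to sign and the factor \<open>sqrt 2\<close>, \<open>h\<close> and \<open>k\<close>
  are the real and imaginary parts of \<open>b\<close>.\<close>

lemma star_mult_sum_swap_eq_squares:
  fixes b :: "'a::cstar_algebra_1"
  obtains h k where "h\<^sup>\<star> = h" "k\<^sup>\<star> = k" "b\<^sup>\<star> * b + b * b\<^sup>\<star> = h * h + k * k"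
proof
  let ?r = "1 / sqrt 2"
  let ?h = "?r *\<^sub>R (b + b\<^sup>\<star>)" and ?k = "\<i> *\<^sub>C (?r *\<^sub>R (b - b\<^sup>\<star>))"
  have m1: "(- 1) *\<^sub>C x = - x" for x :: 'a
    using scaleC_of_real[of "-1" x] by simp
  have mi: "(- \<i>) *\<^sub>C x = \<i> *\<^sub>C (- x)" for x :: 'a
    by (metis m1 scaleC_scaleC mult_minus1_right)
  have ii: "(\<i> *\<^sub>C x) * (\<i> *\<^sub>C x) = - (x * x)" for x :: 'a
    by (simp add: mult_scaleC_left mult_scaleC_right scaleC_scaleC m1)
  show "?h\<^sup>\<star> = ?h" by (simp add: star_scaleR star_add star_star add.commute)
  show "?k\<^sup>\<star> = ?k" by (simp add: star_scaleR star_scaleC star_diff star_star mi flip: scaleR_minus_right)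
  have "?h * ?h = (1/2) *\<^sub>R ((b + b\<^sup>\<star>) * (b + b\<^sup>\<star>))" by simp
  moreover have "?k * ?k = (1/2) *\<^sub>R (- ((b - b\<^sup>\<star>) * (b - b\<^sup>\<star>)))"
    by (subst ii) simp
  ultimately have "?h * ?h + ?k * ?k
      = (1/2) *\<^sub>R ((b + b\<^sup>\<star>) * (b + b\<^sup>\<star>) - (b - b\<^sup>\<star>) * (b - b\<^sup>\<star>))"
    by (simp only: scaleR_add_right[symmetric]) simp
  also have "\<dots> = (1/2) *\<^sub>R (2 *\<^sub>R (b\<^sup>\<star> * b + b * b\<^sup>\<star>))"
    unfolding scaleR_2 by (rule arg_cong[where f = "scaleR (1/2)"]) (simp add: algebra_simps)
  finally show "b\<^sup>\<star> * b + b * b\<^sup>\<star> = ?h * ?h + ?k * ?k" by simp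
qed

text \<open>With \<open>b = 2 \<surd>t x y\<close>, the Cayley transforms \<open>w = 2 y - 1\<close> of \<open>t x\<^sup>\<star> x\<close> and \<open>w' = 1 - 2 t x y x\<^sup>\<star>\<close>
  of \<open>t x x\<^sup>\<star>\<close> satisfy \<open>w\<^sup>2 + b\<^sup>\<star> b = 1 = w'\<^sup>2 + b b\<^sup>\<star>\<close>. Since \<open>b\<^sup>\<star> b + b b\<^sup>\<star>\<close> is a sum of squares,
  so is \<open>2 - w\<^sup>2\<close>, and hence \<open>\<parallel>w\<parallel>\<^sup>2 \<le> 2\<close>.\<close>

lemma norm_inverse_one_plus_le:
  fixes x y :: "'a::cstar_algebra_1"
  assumes t: "t \<ge> 0" and inv: "(1 + t *\<^sub>R (x\<^sup>\<star> * x)) * y = 1" "y * (1 + t *\<^sub>R (x\<^sup>\<star> * x)) = 1"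
  shows "norm y \<le> 2"
proof -
  have ys: "y\<^sup>\<star> = y"
    by (rule inverse_selfadjoint[OF _ inv]) (simp add: star_add star_scaleR star_self_mult)
  \<comment> \<open>This expresses \<open>y\<close> through quadratic terms; \<open>w2\<close> and
    \<open>w'2\<close> both reduce to it.\<close>
  have "y * (1 + t *\<^sub>R (x\<^sup>\<star> * x)) * y = y" by (simp add: inv)
  then have yy: "y * y + t *\<^sub>R (y * x\<^sup>\<star> * x * y) = y"
    by (simp add: distrib_left distrib_right mult.assoc)
  define b where "b = (2 * sqrt t) *\<^sub>R (x * y)"
  define w where "w = 2 *\<^sub>R y - 1"
  define w' where "w' = 1 - (2 * t) *\<^sub>R (x * y * x\<^sup>\<star>)"
  have sa: "w\<^sup>\<star> = w" "w'\<^sup>\<star> = w'"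
    by (simp_all add: w_def w'_def star_diff star_scaleR star_mult star_star ys mult.assoc)
  have bb: "b\<^sup>\<star> * b = 4 *\<^sub>R (t *\<^sub>R (y * x\<^sup>\<star> * x * y))" "b * b\<^sup>\<star> = (4 * t) *\<^sub>R (x * (y * y) * x\<^sup>\<star>)"
    using t by (simp_all add: b_def star_scaleR star_mult ys mult.assoc)
  have w2: "w * w + b\<^sup>\<star> * b = 1"
  proof -
    have "w * w + b\<^sup>\<star> * b = 4 *\<^sub>R (y * y + t *\<^sub>R (y * x\<^sup>\<star> * x * y)) - 4 *\<^sub>R y + 1"
      by (simp add: w_def bb algebra_simps flip: scaleR_add_left)
    then show ?thesis by (simp add: yy)
  qed
  have w'2: "w' * w' + b * b\<^sup>\<star> = 1"
  proof -
    have "w' * w' = 1 - (4 * t) *\<^sub>R (x * y * x\<^sup>\<star>) + (4 * t) *\<^sub>R (x * (t *\<^sub>R (y * x\<^sup>\<star> * x * y)) * x\<^sup>\<star>)"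
      by (simp add: w'_def algebra_simps flip: scaleR_add_left)
    then have "w' * w' + b * b\<^sup>\<star> = 1 - (4 * t) *\<^sub>R (x * y * x\<^sup>\<star>)
        + (4 * t) *\<^sub>R (x * (y * y + t *\<^sub>R (y * x\<^sup>\<star> * x * y)) * x\<^sup>\<star>)"
      unfolding bb by (simp add: distrib_left distrib_right scaleR_add_right)
    then show ?thesis by (simp add: yy)
  qed
  obtain h k where hk: "h\<^sup>\<star> = h" "k\<^sup>\<star> = k" "b\<^sup>\<star> * b + b * b\<^sup>\<star> = h * h + k * k"
    by (rule star_mult_sum_swap_eq_squares)
  \<comment> \<open>The summand 1 provides the strict inequality that
    \<open>norm_scalar_minus_square_le\<close> needs.\<close>
  define T where "T = (\<lambda>s::'a. (norm s)\<^sup>2 + 1)"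
  have Tle: "norm (T s *\<^sub>R 1 - s * s) \<le> T s" if "s\<^sup>\<star> = s" for s
    using norm_scalar_minus_square_le[OF that] by (simp add: T_def)
  have "(norm w)\<^sup>2 \<le> 2"
  proof (rule norm_le_of_positive_complement[OF sa(1)])
    have "w * w + (w' * w' + (h * h + k * k)) = (w * w + b\<^sup>\<star> * b) + (w' * w' + b * b\<^sup>\<star>)"
      unfolding hk(3)[symmetric] by (simp only: add_ac)
    then show "w * w + (w' * w' + (h * h + k * k)) = 2 *\<^sub>R 1"
      by (simp add: w2 w'2 scaleR_2)
    have "(T w' + T h + T k) *\<^sub>R 1 - (w' * w' + (h * h + k * k))
        = (T w' *\<^sub>R 1 - w' * w') + (T h *\<^sub>R 1 - h * h) + (T k *\<^sub>R 1 - k * k)"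
      by (simp add: scaleR_add_left)
    then show "norm ((T w' + T h + T k) *\<^sub>R 1 - (w' * w' + (h * h + k * k))) \<le> T w' + T h + T k"
      using Tle[OF sa(2)] Tle[OF hk(1)] Tle[OF hk(2)]
      by (simp only:) (intro norm_triangle_le add_mono order_trans[OF norm_triangle_ineq], auto)
  qed simp
  then have "(norm w)\<^sup>2 \<le> 2\<^sup>2" by simp
  then have "norm w \<le> 2" by (rule power2_le_imp_le) simp
  moreover have "2 *\<^sub>R y = w + 1" by (simp add: w_def)
  then have "norm (2 *\<^sub>R y) \<le> norm w + 1"
    using norm_triangle_ineq[of w 1] norm_one_le[where 'a='a] by simp
  ultimately show ?thesis by simp
qed

section \<open>Square root of \<open>1 + x\<^sup>\<star> * x\<close> and polar decomposition\<close>

text \<open>The uniform bound on the inverses lets one continue the square root of \<open>1 + t x\<^sup>\<star> x\<close> from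
  \<open>t = 0\<close> to \<open>t = 1\<close> in steps of constant length.\<close>

lemma sqrt_one_plus_star_mult:
  fixes x :: "'a::cstar_algebra_1"
  obtains c d where "c\<^sup>\<star> = c" "c * c = 1 + x\<^sup>\<star> * x" "c * d = 1" "d * c = 1"
    "\<And>z. z * (x\<^sup>\<star> * x) = x\<^sup>\<star> * x * z \<Longrightarrow> z * c = c * z"
proof -
  define a where "a = x\<^sup>\<star> * x"
  have as: "a\<^sup>\<star> = a" by (simp add: a_def star_self_mult)
  \<comment> \<open>As inverses have norm at most 2, steps of length \<open>1 / n\<close> keep the
    correction \<open>e\<close> below norm 1.\<close>
  obtain n :: nat where n: "2 * norm a < real n" using reals_Archimedean2 by blast
  then have "n > 0" using norm_ge_zero[of a] by (cases n) auto
  \<comment> \<open>The commutation clause makes the next factor \<open>d\<close> commute with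
    \<open>c\<close>, so that \<open>c * d\<close> is again a self-adjoint root.\<close>
  define P where "P = (\<lambda>t y c. (1 + t *\<^sub>R a) * y = 1 \<and> y * (1 + t *\<^sub>R a) = 1 \<and> c\<^sup>\<star> = c \<and>
    c * c = 1 + t *\<^sub>R a \<and> (\<forall>z. z * a = a * z \<longrightarrow> z * c = c * z))"
  have "\<exists>y c. P (real j / real n) y c" for j :: nat
  proof (induction j)
    case 0
    show ?case by (rule exI[of _ 1], rule exI[of _ 1]) (simp add: P_def)
  next
    case (Suc j)
    define t where "t = real j / real n"
    define t' where "t' = real (Suc j) / real n"
    have t': "t' = t + 1 / real n" by (simp add: t_def t'_def add_divide_distrib)
    from Suc obtain y c where y: "(1 + t *\<^sub>R a) * y = 1" "y * (1 + t *\<^sub>R a) = 1"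
      and c: "c\<^sup>\<star> = c" "c * c = 1 + t *\<^sub>R a" "\<And>z. z * a = a * z \<Longrightarrow> z * c = c * z"
      unfolding P_def t_def by blast
    have "norm y \<le> 2"
      by (rule norm_inverse_one_plus_le[of t x]) (use y in \<open>auto simp: a_def t_def\<close>)
    have ys: "y\<^sup>\<star> = y"
      by (rule inverse_selfadjoint[OF _ y]) (simp add: star_add star_scaleR as)
    have zy: "z * y = y * z" if "z * a = a * z" for z
      by (rule inverse_commute[OF y]) (simp add: algebra_simps that)
    \<comment> \<open>Chosen so that multiplying \<open>1 + t *\<^sub>R a\<close> by
      \<open>1 - e\<close> advances \<open>t\<close> by \<open>1 / n\<close>.\<close>
    define e where "e = - (1 / real n) *\<^sub>R (y * a)"
    have "norm (y * a) \<le> 2 * norm a"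
      using \<open>norm y \<le> 2\<close> by (meson norm_mult_ineq mult_right_mono norm_ge_zero order_trans)
    then have "norm e < 1" using n \<open>n > 0\<close> by (simp add: e_def field_simps)
    have es: "e\<^sup>\<star> = e" using zy[of a] by (simp add: e_def star_scaleR star_minus star_mult as ys)
    have ze: "z * e = e * z" if "z * a = a * z" for z
    proof -
      have "z * (y * a) = y * a * z" using zy[OF that] that by (metis mult.assoc)
      then show ?thesis by (simp add: e_def)
    qed
    obtain d where d: "d\<^sup>\<star> = d" "d * d = 1 - e" "\<And>z. z * e = e * z \<Longrightarrow> z * d = d * z"
      using sqrt_one_minus[OF es \<open>norm e < 1\<close>] by blast
    obtain y' where y': "(1 - e) * y' = 1" "y' * (1 - e) = 1"
      using neumann_inverse[OF \<open>norm e < 1\<close>] by blast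
    have step: "(1 + t *\<^sub>R a) * (1 - e) = 1 + t' *\<^sub>R a"
    proof -
      have "(1 + t *\<^sub>R a) * (1 - e)
          = 1 + t *\<^sub>R a + (1 / real n) *\<^sub>R ((1 + t *\<^sub>R a) * y * a)"
        by (simp add: e_def distrib_left mult.assoc)
      then show ?thesis by (simp add: y t' scaleR_add_left)
    qed
    have dc: "d * c = c * d" using c(3)[of d] d(3)[OF ze[OF refl]] by simp
    have "P t' (y' * y) (c * d)"
      unfolding P_def
    proof (intro conjI allI impI)
      show "(1 + t' *\<^sub>R a) * (y' * y) = 1"
      proof -
        have "(1 + t' *\<^sub>R a) * (y' * y) = (1 + t *\<^sub>R a) * ((1 - e) * y') * y"
          by (simp only: step[symmetric] mult.assoc)
        then show ?thesis by (simp add: y y')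
      qed
      show "y' * y * (1 + t' *\<^sub>R a) = 1"
      proof -
        have "y' * y * (1 + t' *\<^sub>R a) = y' * (y * (1 + t *\<^sub>R a)) * (1 - e)"
          by (simp only: step[symmetric] mult.assoc)
        then show ?thesis by (simp add: y y')
      qed
      show "(c * d)\<^sup>\<star> = c * d" by (simp add: star_mult c d dc)
      have "(c * d) * (c * d) = (c * c) * (d * d)" by (metis dc mult.assoc)
      then show "(c * d) * (c * d) = 1 + t' *\<^sub>R a" by (simp only: c d step)
      show "z * (c * d) = c * d * z" if "z * a = a * z" for z
        using c(3)[OF that] d(3)[OF ze[OF that]] by (metis mult.assoc)
    qed
    then show ?case unfolding t'_def by blast
  qed
  from this[of n] obtain y c where "P 1 y c" using \<open>n > 0\<close> by auto
  then have y: "(1 + a) * y = 1" "y * (1 + a) = 1"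
    and c: "c\<^sup>\<star> = c" "c * c = 1 + a" "\<And>z. z * a = a * z \<Longrightarrow> z * c = c * z"
    unfolding P_def by auto
  \<comment> \<open>The inverse of the root is \<open>c * y\<close>, because \<open>c * c\<close>
    has inverse \<open>y\<close> and \<open>c\<close> commutes with \<open>y\<close>.\<close>
  have "c * a = a * c" using c(3)[of a] by simp
  then have "c * y = y * c"
    by (intro inverse_commute[OF y]) (simp add: distrib_left distrib_right)
  then have "c * (c * y) = 1" "(c * y) * c = 1"
    using y c(2) by (metis mult.assoc)+
  then show ?thesis using that c unfolding a_def by blast
qed

text \<open>A left-invertible \<open>x\<close> is bounded below: for \<open>N > \<parallel>y\<parallel>\<^sup>2\<close> and \<open>m = sqrt (N - y\<^sup>\<star> y) x\<close> one has
  \<open>N x\<^sup>\<star> x = r + m\<^sup>\<star> m\<close>, so \<open>g\<close> is a multiple of \<open>(1 + m\<^sup>\<star> m)\<^sup>-\<^sup>1\<^sup>/\<^sup>2\<close>.\<close>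

lemma polar_decomposition:
  fixes x y r :: "'a::cstar_algebra_1"
  assumes r: "projection r" and xr: "x * r = x" and yx: "y * x = r"
  obtains v g g' where "v\<^sup>\<star> * v = r" "v * r = v" "v = x * g" "x = v * g'"
proof -
  have rs: "r\<^sup>\<star> = r" "r * r = r" using r by (auto simp: projection_def)
  have rx: "r * x\<^sup>\<star> = x\<^sup>\<star>" using star_mult[of x r] by (simp add: xr rs)
  define N where "N = (norm y)\<^sup>2 + 1"
  have "N > 0" by (simp add: N_def add_nonneg_pos)
  obtain z where z: "z\<^sup>\<star> = z" "z * z = N *\<^sub>R 1 - y\<^sup>\<star> * y"
  proof (rule sqrt_near_scalar)
    show "(N *\<^sub>R 1 - y\<^sup>\<star> * y)\<^sup>\<star> = N *\<^sub>R 1 - y\<^sup>\<star> * y"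
      by (simp add: star_diff star_scaleR star_self_mult)
    show "norm (N *\<^sub>R 1 - (N *\<^sub>R 1 - y\<^sup>\<star> * y)) < N"
      by (simp add: cstar_identity N_def)
  qed blast
  define m where "m = z * x"
  have "m\<^sup>\<star> * m = x\<^sup>\<star> * (z * z) * x" by (simp add: m_def star_mult z(1) mult.assoc)
  also have "\<dots> = N *\<^sub>R (x\<^sup>\<star> * x) - (y * x)\<^sup>\<star> * (y * x)"
    by (simp add: z algebra_simps star_mult)
  finally have mm: "m\<^sup>\<star> * m = N *\<^sub>R (x\<^sup>\<star> * x) - r" by (simp add: yx rs)
  obtain c d where c: "c\<^sup>\<star> = c" "c * c = 1 + m\<^sup>\<star> * m" "c * d = 1" "d * c = 1"
    "\<And>z. z * (m\<^sup>\<star> * m) = m\<^sup>\<star> * m * z \<Longrightarrow> z * c = c * z"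
    by (rule sqrt_one_plus_star_mult[of m]) blast
  have "r * (m\<^sup>\<star> * m) = m\<^sup>\<star> * m * r"
    unfolding mm by (simp add: algebra_simps rs xr) (simp add: rx flip: mult.assoc)
  then have rc: "r * c = c * r" by (rule c)
  have rd: "r * d = d * r" by (rule inverse_commute[OF c(3,4) rc])
  have ds: "d\<^sup>\<star> = d" by (rule inverse_selfadjoint[OF c(1,3,4)])
  \<comment> \<open>Since \<open>c * c * r\<close> equals
    \<open>N *\<^sub>R (x\<^sup>\<star> * x)\<close>, the square of \<open>g\<close> inverts
    \<open>x\<^sup>\<star> * x\<close> on the corner of \<open>r\<close>.\<close>
  define g where "g = sqrt N *\<^sub>R d"
  define g' where "g' = (1 / sqrt N) *\<^sub>R c"
  define v where "v = x * g"
  show ?thesis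
  proof
    have "v\<^sup>\<star> * v = d * (N *\<^sub>R (x\<^sup>\<star> * x)) * d"
      using \<open>N > 0\<close> by (simp add: v_def g_def star_mult star_scaleR ds mult.assoc)
    also have "N *\<^sub>R (x\<^sup>\<star> * x) = c * c * r"
      unfolding c mm by (simp add: algebra_simps rs xr)
    also have "d * (c * c * r) * d = (d * c) * (c * (r * d))" by (simp only: mult.assoc)
    also have "\<dots> = (c * d) * r" unfolding rd c(4) by (simp add: mult.assoc)
    finally show "v\<^sup>\<star> * v = r" by (simp add: c)
    have "x * d * r = x * d" using rd xr by (metis mult.assoc)
    then show "v * r = v" by (simp add: v_def g_def)
    show "v = x * g" by (simp add: v_def)
    show "x = v * g'" using \<open>N > 0\<close> c by (simp add: v_def g_def g'_def mult.assoc)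
  qed
qed

section \<open>Partial isometries, adjoints and the ideal\<close>

text \<open>The defect \<open>d\<close> satisfies \<open>d\<^sup>\<star> * d = 0\<close>, so it
  vanishes by the C*-identity.\<close>

lemma mult_star_projection_absorb:
  fixes v :: "'a::cstar_algebra_1"
  assumes "projection (v * v\<^sup>\<star>)"
  shows "v * v\<^sup>\<star> * v = v"
proof -
  let ?p = "v * v\<^sup>\<star>"
  have pp: "?p * ?p = ?p" using assms by (simp add: projection_def)
  define d where "d = v\<^sup>\<star> - v\<^sup>\<star> * ?p"
  have "d\<^sup>\<star> * d = (v - ?p * v) * (v\<^sup>\<star> - v\<^sup>\<star> * ?p)"
    by (simp add: d_def star_diff star_mult star_star mult.assoc)
  also have "\<dots> = ?p - ?p * ?p - ?p * ?p + ?p * ?p * ?p"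
    by (simp add: algebra_simps)
  also have "\<dots> = 0" by (simp add: pp)
  finally have "d = 0" using cstar_identity[of d] by simp
  then have "d\<^sup>\<star> = 0" by simp
  then show ?thesis by (simp add: d_def star_diff star_mult star_star)
qed

text \<open>The adjoint of the corner inverse \<open>b\<close> is the required inverse; taking
  adjoints exchanges the roles of \<open>p\<close> and \<open>q\<close>.\<close>

lemma invertible_upto_star:
  fixes a p q :: "'a::cstar_algebra_1"
  assumes "projection p" "projection q" "invertible_upto a p q"
  shows "invertible_upto (a\<^sup>\<star>) q p"
proof -
  have s: "p\<^sup>\<star> = p" "q\<^sup>\<star> = q" using assms by (auto simp: projection_def)
  obtain b where b: "b = (1 - p) * b * (1 - q)" "(1 - q) * a * (1 - p) * b = 1 - q"
    "b * ((1 - q) * a * (1 - p)) = 1 - p"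
    using assms(3) by (auto simp: invertible_upto_def Let_def)
  have "b\<^sup>\<star> = (1 - q) * b\<^sup>\<star> * (1 - p)"
    by (subst b(1)) (simp add: star_mult star_diff s mult.assoc)
  moreover have "(1 - p) * a\<^sup>\<star> * (1 - q) * b\<^sup>\<star> = 1 - p"
    using arg_cong[OF b(3), of star] by (simp add: star_mult star_diff s mult.assoc)
  moreover have "b\<^sup>\<star> * ((1 - p) * a\<^sup>\<star> * (1 - q)) = 1 - q"
    using arg_cong[OF b(2), of star] by (simp add: star_mult star_diff s mult.assoc)
  ultimately show ?thesis by (auto simp: invertible_upto_def Let_def)
qed

lemma finite_type_idealD:
  fixes F :: "'a::cstar_algebra_1 set"
  assumes "finite_type_ideal TYPE('i) F"
  shows "x \<in> F \<Longrightarrow> y \<in> F \<Longrightarrow> x + y \<in> F" "x \<in> F \<Longrightarrow> a * x \<in> F" "x \<in> F \<Longrightarrow> x * a \<in> F"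
    "x \<in> F \<Longrightarrow> x\<^sup>\<star> \<in> F" "x \<in> F \<Longrightarrow> y \<in> F \<Longrightarrow> x - y \<in> F"
proof -
  show add: "x + y \<in> F" if "x \<in> F" "y \<in> F" for x y
    using assms that by (auto simp: finite_type_ideal_def subalgebra_def)
  show mult: "a * x \<in> F" "x * a \<in> F" "x\<^sup>\<star> \<in> F" if "x \<in> F" for a x
    using assms that by (auto simp: finite_type_ideal_def)
  show "x - y \<in> F" if "x \<in> F" "y \<in> F"
    using add[OF that(1) mult(1)[OF that(2), of "- 1"]] by simp
qed

lemma finite_type_ideal_approx:
  fixes F :: "'a::cstar_algebra_1 set"
  assumes "finite_type_ideal TYPE('i) F" "f \<in> F" "\<epsilon> > 0"
  obtains r where "r \<in> F" "projection r" "norm (f * r - f) < \<epsilon>"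
proof -
  obtain I :: "'i set" and R u where u: "approximate_unit F I R u" "\<forall>i\<in>I. projection (u i)"
    using assms(1) by (auto simp: finite_type_ideal_def)
  then obtain i where i: "i \<in> I" "\<forall>j\<in>I. (i, j) \<in> R \<longrightarrow> norm (f * u j - f) < \<epsilon>"
    using assms(2,3) unfolding approximate_unit_def by blast
  \<comment> \<open>Reflexivity allows the estimate to be used at the index \<open>i\<close>
    itself.\<close>
  have "(i, i) \<in> R"
    using u(1) i(1) by (auto simp: approximate_unit_def preorder_on_def dest: refl_onD)
  then show ?thesis
    using that[of "u i"] u i by (auto simp: approximate_unit_def)
qed

section \<open>Invertibility up to projections versus one-sided invertibility modulo
  \<open>F\<close>\<close>

text \<open>The map \<open>1 - q a b\<close> is invertible and removes the lower left corner \<open>q a (1 - p)\<close> of \<open>a\<close>; the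
  remaining corners to the right of \<open>p\<close> lie in \<open>F\<close> and may be replaced by \<open>v\<^sup>\<star>\<close>.\<close>

lemma invertible_upto_imp_left_invertible_plus_ideal:
  fixes F :: "'a::cstar_algebra_1 set"
  assumes F: "finite_type_ideal TYPE('i) F"
    and p: "projection p" "p \<in> F" and q: "projection q" and inv: "invertible_upto a p q"
    and v: "v * v\<^sup>\<star> = p" and vq: "q * (v\<^sup>\<star> * v) = v\<^sup>\<star> * v"
  obtains h c where "c * h = 1" "a - h \<in> F" "v\<^sup>\<star> * v = q \<Longrightarrow> h * c = 1"
proof -
  have ps: "p\<^sup>\<star> = p" "p * p = p" and qs: "q\<^sup>\<star> = q" "q * q = q"
    using p q by (auto simp: projection_def)
  define a' where "a' = (1 - q) * a * (1 - p)"
  obtain b where b: "b = (1 - p) * b * (1 - q)" "a' * b = 1 - q" "b * a' = 1 - p"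
    using inv unfolding invertible_upto_def Let_def a'_def[symmetric] by blast
  have q0: "q * (1 - q) = 0" "(1 - q) * q = 0" "(1 - p) * p = 0" "p * (1 - p) = 0"
    by (simp_all add: left_diff_distrib right_diff_distrib ps qs)
  have bq: "b * q = 0" by (subst b(1)) (simp add: mult.assoc q0)
  have pb: "p * b = 0" by (subst b(1)) (simp add: q0 flip: mult.assoc)
  have a'p: "a' * p = 0" by (simp add: a'_def mult.assoc q0)
  have qa': "q * a' = 0" by (simp add: a'_def q0 flip: mult.assoc)
  have pv: "p * v = v"
    using mult_star_projection_absorb[of v] p v by simp
  then have vp: "v\<^sup>\<star> * p = v\<^sup>\<star>" using star_mult[of p v] ps by simp
  have qv: "q * v\<^sup>\<star> = v\<^sup>\<star>"
    using vq vp v by (metis mult.assoc)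
  then have vq': "v * q = v" using star_mult[of q "v\<^sup>\<star>"] qs by (simp add: star_star)
  \<comment> \<open>The square of \<open>n\<close> is zero because \<open>b * q = 0\<close>, so
    \<open>1 - n\<close> and \<open>1 + n\<close> are mutually inverse.\<close>
  define n where "n = q * a * b"
  have nn: "n * n = 0"
  proof -
    have "n * n = q * a * (b * q) * (a * b)" by (simp add: n_def mult.assoc)
    then show ?thesis by (simp add: bq)
  qed
  have n1: "(1 - n) * (1 + n) = 1" "(1 + n) * (1 - n) = 1"
    by (simp_all add: algebra_simps nn)
  \<comment> \<open>The diagonal products give \<open>1 - p\<close> and \<open>p\<close>; the cross
    terms vanish because they live in complementary corners.\<close>
  have left: "(b + v) * (a' + v\<^sup>\<star>) = 1"
  proof -
    have "b * v\<^sup>\<star> = 0" by (metis bq qv mult.assoc mult_zero_left)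
    moreover have "v * a' = 0" by (metis qa' vq' mult.assoc mult_zero_right)
    ultimately show ?thesis by (simp add: distrib_left distrib_right b(3) v)
  qed
  have right: "(a' + v\<^sup>\<star>) * (b + v) = 1" if "v\<^sup>\<star> * v = q"
  proof -
    have "a' * v = 0" by (metis a'p pv mult.assoc mult_zero_left)
    moreover have "v\<^sup>\<star> * b = 0" by (metis pb vp mult.assoc mult_zero_right)
    ultimately show ?thesis by (simp add: distrib_left distrib_right b(2) that)
  qed
  have red: "(1 - n) * a * (1 - p) = a'"
  proof -
    have b1q: "b * (1 - q) = b" by (simp add: right_diff_distrib bq)
    have "b * a * (1 - p) = b * a'"
      by (simp add: a'_def b1q flip: mult.assoc)
    then have "n * a * (1 - p) = q * a * (1 - p)"
      by (simp add: n_def mult.assoc b(3))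
    then show ?thesis
      by (simp add: a'_def left_diff_distrib)
  qed
  define h where "h = (1 + n) * (a' + v\<^sup>\<star>)"
  define c where "c = (b + v) * (1 - n)"
  show ?thesis
  proof
    have "c * h = (b + v) * ((1 - n) * (1 + n)) * (a' + v\<^sup>\<star>)"
      by (simp only: c_def h_def mult.assoc)
    then show "c * h = 1" by (simp add: n1 left)
    show "h * c = 1" if "v\<^sup>\<star> * v = q"
    proof -
      have "h * c = (1 + n) * ((a' + v\<^sup>\<star>) * (b + v)) * (1 - n)"
        by (simp only: c_def h_def mult.assoc)
      then show ?thesis by (simp add: n1 right[OF that])
    qed
    have "a = (1 + n) * ((1 - n) * a)" by (simp add: n1 flip: mult.assoc)
    also have "(1 - n) * a = (1 - n) * a * (1 - p) + (1 - n) * a * p"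
      by (simp add: right_diff_distrib)
    finally have "a = (1 + n) * (a' + (1 - n) * a * p)" by (simp only: red)
    \<comment> \<open>Both terms end in \<open>p\<close>, since
      \<open>v\<^sup>\<star> = v\<^sup>\<star> * p\<close>, and therefore lie in
      \<open>F\<close>.\<close>
    then have "a - h = (1 + n) * ((1 - n) * a * p - v\<^sup>\<star> * p)"
      unfolding h_def by (metis add_diff_cancel_left right_diff_distrib vp)
    then show "a - h \<in> F"
      using finite_type_idealD[OF F] p by metis
  qed
qed

text \<open>For \<open>r\<close> far out in the approximate unit, \<open>k = h + f (1 - r)\<close> is still left invertible and
  agrees with \<open>h + f\<close> on \<open>1 - r\<close>. Take for \<open>1 - q\<close> the range projection of \<open>k (1 - r)\<close>; then \<open>v\<close> is
  the polar part of \<open>q k r\<close>.\<close>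

lemma left_invertible_plus_ideal_imp_invertible_upto:
  fixes F :: "'a::cstar_algebra_1 set"
  assumes F: "finite_type_ideal TYPE('i) F" and ch: "c * h = 1" and f: "f \<in> F"
  obtains r q v where "projection r" "r \<in> F" "projection q" "invertible_upto (h + f) r q"
    "v\<^sup>\<star> * v = r" "q * v = v" "h * c = 1 \<Longrightarrow> q \<in> F \<and> v * v\<^sup>\<star> = q"
proof -
  \<comment> \<open>This tolerance gives \<open>norm e < 1\<close>; the added 1 keeps the
    denominator positive when \<open>c = 0\<close>.\<close>
  obtain r where r: "r \<in> F" "projection r" "norm (f * r - f) < 1 / (norm c + 1)"
    using finite_type_ideal_approx[OF F f, of "1 / (norm c + 1)"]
    by (auto simp: add_nonneg_pos)
  have rs: "r\<^sup>\<star> = r" "r * r = r" using r by (auto simp: projection_def)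
  define e where "e = c * (f * r - f)"
  have "norm e \<le> norm c * norm (f * r - f)" by (simp add: e_def norm_mult_ineq)
  also have "\<dots> \<le> (norm c + 1) * norm (f * r - f)" by (simp add: mult_right_mono)
  also have "\<dots> < 1" using r(3) by (simp add: pos_less_divide_eq add_nonneg_pos mult.commute)
  finally obtain y where y: "(1 - e) * y = 1" "y * (1 - e) = 1"
    using neumann_inverse by blast
  define k where "k = h - (f * r - f)"
  define d where "d = y * c"
  have "c * k = 1 - e" by (simp add: k_def e_def right_diff_distrib ch)
  then have dk: "d * k = 1" by (simp add: d_def mult.assoc y)
  have kd: "k * d = 1" if hc: "h * c = 1"
  proof -
    have "h * (1 - e) = k"
      by (simp add: e_def k_def right_diff_distrib hc flip: mult.assoc)
    then have "k * d = h * ((1 - e) * y) * c" by (simp add: d_def flip: mult.assoc)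
    then show ?thesis by (simp add: y hc)
  qed
  define s where "s = 1 - r"
  have s: "projection s" "s * s = s" "r * s = 0" "s * r = 0" "r + s = 1"
    by (simp_all add: s_def projection_def star_diff rs algebra_simps)
  define x where "x = k * s"
  have hfs: "(h + f) * s = x"
    by (simp add: x_def k_def s_def algebra_simps rs)
  have xs: "x * s = x" by (simp add: x_def mult.assoc s)
  have dx: "d * x = s" by (simp add: x_def dk flip: mult.assoc)
  have "s * d * x = s" by (simp add: mult.assoc dx s)
  then obtain w g g' where w: "w\<^sup>\<star> * w = s" "w * s = w" "w = x * g" "x = w * g'"
    using polar_decomposition[OF s(1) xs] by blast
  define q where "q = 1 - w * w\<^sup>\<star>"
  have ww: "w * w\<^sup>\<star> * (w * w\<^sup>\<star>) = w * w\<^sup>\<star>"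
    by (metis w(1,2) mult.assoc)
  have q: "projection q"
    by (simp add: q_def projection_def star_diff star_mult star_star left_diff_distrib
        right_diff_distrib ww)
  have qq: "q * q = q" and qs: "q\<^sup>\<star> = q" using q by (auto simp: projection_def)
  have wwx: "w * w\<^sup>\<star> * x = x"
    by (metis w(1,2,4) mult.assoc)
  have qx: "q * x = 0" by (simp add: q_def left_diff_distrib wwx)
  define z where "z = q * k * r"
  have zr: "z * r = z" by (simp add: z_def mult.assoc rs)
  \<comment> \<open>The map \<open>r * d\<close> kills the range of \<open>w\<close>, because
    \<open>d * x = s\<close> and \<open>r * s = 0\<close>. Hence \<open>r * d\<close> is a left
    inverse of \<open>z\<close> on the corner of \<open>r\<close>.\<close>
  have rdq: "r * d * q = r * d"
  proof -
    have "r * d * w = r * (d * x) * g" by (simp add: w(3) mult.assoc)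
    then have "r * d * w = 0" by (simp add: dx s)
    then show ?thesis by (simp add: q_def right_diff_distrib flip: mult.assoc)
  qed
  have "r * d * z = r * d * q * k * r" by (simp add: z_def mult.assoc)
  also have "\<dots> = r" by (simp add: rdq) (simp add: mult.assoc dk rs)
  finally obtain v m m' where v: "v\<^sup>\<star> * v = r" "v * r = v" "v = z * m" "z = v * m'"
    using polar_decomposition[OF r(2) zr] by blast
  have qv: "q * v = v"
    by (simp add: v(3) z_def qq flip: mult.assoc)
  have up: "invertible_upto (h + f) r q"
    unfolding invertible_upto_def Let_def
  proof (intro exI conjI)
    \<comment> \<open>The element \<open>d\<close> inverts \<open>x\<close> from the left;
      restricting to the range of \<open>w\<close>, where \<open>w = x * g\<close>, makes the
      inverse two-sided.\<close>
    let ?b = "s * d * (w * w\<^sup>\<star>)"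
    have one: "1 - q = w * w\<^sup>\<star>" "1 - r = s" by (simp_all add: q_def s_def)
    have a': "(1 - q) * (h + f) * (1 - r) = x"
      by (simp add: one mult.assoc hfs) (simp add: wwx flip: mult.assoc)
    show "?b = (1 - r) * ?b * (1 - q)"
      unfolding one by (metis ww s(2) mult.assoc)
    have "?b * x = s * (d * (w * w\<^sup>\<star> * x))" by (simp only: mult.assoc)
    then show "?b * ((1 - q) * (h + f) * (1 - r)) = 1 - r"
      unfolding a' by (simp add: wwx dx s one(2))
    have "x * ?b = (x * s) * (d * x) * g * w\<^sup>\<star>"
      by (simp add: w(3) mult.assoc)
    also have "\<dots> = x * g * w\<^sup>\<star>" by (simp add: xs dx)
    finally show "(1 - q) * (h + f) * (1 - r) * ?b = 1 - q"
      unfolding a' by (simp add: one w(3)[symmetric])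
  qed
  have "q \<in> F \<and> v * v\<^sup>\<star> = q" if "h * c = 1"
  proof -
    \<comment> \<open>With \<open>k\<close> now invertible, \<open>q\<close> factors through
      \<open>z\<close>: the part of \<open>k\<close> on \<open>s\<close> is annihilated by
      \<open>q\<close>. So \<open>q\<close> lies in \<open>F\<close> and in the range of
      \<open>v\<close>.\<close>
    have "q = q * (k * (r + s) * d)" using kd[OF that] by (simp add: s(5))
    also have "\<dots> = z * d + q * x * d" by (simp add: z_def x_def algebra_simps)
    finally have qz: "q = z * d" by (simp add: qx)
    have "z \<in> F" using finite_type_idealD[OF F] r(1) by (simp add: z_def)
    then have "q \<in> F" using finite_type_idealD[OF F] qz by metis
    have "v * v\<^sup>\<star> * q = v * (v\<^sup>\<star> * v) * m' * d" by (simp add: qz v(4) mult.assoc)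
    also have "\<dots> = q" by (simp add: v(1,2)) (simp add: qz v(4))
    finally have "v * v\<^sup>\<star> * q = q" .
    moreover have "v\<^sup>\<star> * q = v\<^sup>\<star>" using star_mult[of q v] by (simp add: qv qs)
    ultimately show ?thesis using \<open>q \<in> F\<close> by (simp add: mult.assoc)
  qed
  then show ?thesis using that r q up v(1) qv by blast
qed

section \<open>Stability of the three classes under perturbation by \<open>F\<close>\<close>

text \<open>Write \<open>a\<close> as a left-invertible \<open>h\<close> plus an ideal element,
  absorb \<open>f\<close> into the latter, and return; the partial isometry \<open>w\<close> embeds
  \<open>r\<close> below \<open>q'\<close>.\<close>

lemma upper_semi_Weyl_add_ideal:
  fixes F :: "'a::cstar_algebra_1 set"
  assumes F: "finite_type_ideal TYPE('i) F" and f: "f \<in> F" and a: "a \<in> \<K>\<Phi>\<^sub>+\<^sup>- F"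
  shows "a + f \<in> \<K>\<Phi>\<^sub>+\<^sup>- F"
proof -
  obtain p q v where p: "projection p" "p \<in> F" and q: "projection q" "invertible_upto a p q"
    and v: "v * v\<^sup>\<star> = p" "q * (v\<^sup>\<star> * v) = v\<^sup>\<star> * v"
    using a by (auto simp: upper_semi_Weyl_def mvn_le_def mvn_equiv_def subprojection_def)
  obtain h c where h: "c * h = 1" "a - h \<in> F"
    using invertible_upto_imp_left_invertible_plus_ideal[OF F p q v] by blast
  have mem: "a - h + f \<in> F" and eq: "h + (a - h + f) = a + f"
    using finite_type_idealD(1)[OF F h(2) f] by simp_all
  obtain r q' w where r: "projection r" "r \<in> F" "projection q'" "invertible_upto (a + f) r q'"
    "w\<^sup>\<star> * w = r" "q' * w = w"
    using left_invertible_plus_ideal_imp_invertible_upto[OF F h(1) mem] unfolding eq by blast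
  have wr: "w * r = w"
    using mult_star_projection_absorb[of "w\<^sup>\<star>"] r(1,5) star_mult[of r "w\<^sup>\<star>"]
    by (auto simp: star_star projection_def)
  have wq: "w\<^sup>\<star> * q' = w\<^sup>\<star>"
    using star_mult[of q' w] r(3,6) by (simp add: projection_def)
  have "projection (w * w\<^sup>\<star>)"
    unfolding projection_def star_mult star_star using wr r(5) by (metis mult.assoc)
  then have "subprojection (w * w\<^sup>\<star>) q'"
    using r(3,6) wq by (simp add: subprojection_def mult.assoc) (simp flip: mult.assoc)
  moreover have "r \<approx>\<^sub>M w * w\<^sup>\<star>"
    unfolding mvn_equiv_def by (rule exI[of _ "w\<^sup>\<star>"]) (simp add: star_star r)
  ultimately show ?thesis
    using r unfolding upper_semi_Weyl_def mvn_le_def by blast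
qed

text \<open>Equivalence of \<open>p\<close> and \<open>q\<close> makes \<open>h\<close> invertible
  on both sides, which in turn makes \<open>w\<close> reach all of \<open>q'\<close>.\<close>

lemma Weyl_add_ideal:
  fixes F :: "'a::cstar_algebra_1 set"
  assumes F: "finite_type_ideal TYPE('i) F" and f: "f \<in> F" and a: "a \<in> \<K>\<Phi>\<^sub>0 F"
  shows "a + f \<in> \<K>\<Phi>\<^sub>0 F"
proof -
  obtain p q v where p: "projection p" "p \<in> F" and q: "projection q" "invertible_upto a p q"
    and v: "v * v\<^sup>\<star> = p" "v\<^sup>\<star> * v = q"
    using a by (auto simp: Weyl_def mvn_equiv_def)
  have "q * (v\<^sup>\<star> * v) = v\<^sup>\<star> * v" using q(1) v(2) by (simp add: projection_def)
  then obtain h c where h: "c * h = 1" "a - h \<in> F" "h * c = 1"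
    using invertible_upto_imp_left_invertible_plus_ideal[OF F p q v(1)] v(2) by blast
  have mem: "a - h + f \<in> F" and eq: "h + (a - h + f) = a + f"
    using finite_type_idealD(1)[OF F h(2) f] by simp_all
  obtain r q' w where r: "projection r" "r \<in> F" "projection q'" "invertible_upto (a + f) r q'"
    "w\<^sup>\<star> * w = r" "q' \<in> F" "w * w\<^sup>\<star> = q'"
    using left_invertible_plus_ideal_imp_invertible_upto[OF F h(1) mem] h(3) unfolding eq by blast
  have "r \<approx>\<^sub>M q'"
    unfolding mvn_equiv_def by (rule exI[of _ "w\<^sup>\<star>"]) (simp add: star_star r)
  then show ?thesis using r unfolding Weyl_def by blast
qed

text \<open>Taking adjoints swaps the two projections, which reduces the lower case to the upper
  one.\<close>

lemma lower_semi_Weyl_iff_star: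
  fixes F :: "'a::cstar_algebra_1 set"
  shows "a \<in> \<K>\<Phi>\<^sub>-\<^sup>+ F \<longleftrightarrow> a\<^sup>\<star> \<in> \<K>\<Phi>\<^sub>+\<^sup>- F"
  unfolding lower_semi_Weyl_def upper_semi_Weyl_def mem_Collect_eq
  using invertible_upto_star[of _ _ a] invertible_upto_star[of _ _ "a\<^sup>\<star>"] by (metis star_star)

theorem proposition3p19:
  fixes F :: "'a::cstar_algebra_1 set" and a :: 'a
  assumes "finite_type_ideal TYPE('i) F"
  shows "(\<forall>f\<in>F. a \<in> \<K>\<Phi>\<^sub>+\<^sup>- F \<longrightarrow> a + f \<in> \<K>\<Phi>\<^sub>+\<^sup>- F) \<and>
         (\<forall>f\<in>F. a \<in> \<K>\<Phi>\<^sub>-\<^sup>+ F \<longrightarrow> a + f \<in> \<K>\<Phi>\<^sub>-\<^sup>+ F) \<and>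
         (\<forall>f\<in>F. a \<in> \<K>\<Phi>\<^sub>0 F \<longrightarrow> a + f \<in> \<K>\<Phi>\<^sub>0 F)"
  using upper_semi_Weyl_add_ideal[OF assms] Weyl_add_ideal[OF assms]
    finite_type_idealD(4)[OF assms]
  by (simp add: lower_semi_Weyl_iff_star star_add)

end
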